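(* For all integers $r \ge 0$ and $k\ge 1$, every OBDD computing the Boolean function of $F_{r,k}$ (under any variable order) has at least $2^{rk/2}$ nodes.
   Context: For a graph $G$, the graph-based CNF $CNF(G)$ has a variable $X_u$ for each vertex $u \in V(G)$ and a variable $X_{u,v}=X_{v,u}$ for each edge $\{u,v\}\in E(G)$; its clauses are $(X_u \vee X_{u,v} \vee X_v)$, one for each edge $\{u,v\} \in E(G)$. Let $T_r$ be the complete binary tree of height $r$ (with $2^{r+1}-1$ nodes). $CT_{r,k}$ is obtained from $T_r$ by replacing each node by a clique on $k$ vertices (vertex-disjoint) and, for each edge $\{a,b\}$ of $T_r$, making all vertices of the clique of $a$ adjacent to all vertices of the clique of $b$. $F_{r,k}=CNF(CT_{r,k})$. An OBDD for a Boolean function $F$ is a rooted DAG with two sinks labelled $true$ and $false$, whose internal nodes are labelled by variables of $F$ and have two outgoing edges labelled $true$ and $false$, such that there is a fixed linear order of the variables with which the labels along every root-to-sink path comply, and the assignments read along root-to-$true$ paths are exactly the satisfying assignments of $F$. Its size is its number of nodes. *)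

theory Defs
  imports Complex_Main
begin

record 'a ugraph =
  verts :: "'a set"
  edges :: "'a set set"

record 'x cnf =
  cnf_vars :: "'x set"
  cnf_clauses :: "('x \<times> bool) set set"

text \<open>A literal is a pair \<open>(x, b)\<close>, satisfied when \<open>x\<close> is assigned \<open>b\<close>.  The variable set is
  kept explicitly since a variable need not occur in any clause (isolated vertices below).\<close>

definition sat_assignments :: "'x cnf \<Rightarrow> ('x \<rightharpoonup> bool) set" where
  "sat_assignments F =
     {\<sigma>. dom \<sigma> = cnf_vars F \<and> (\<forall>C\<in>cnf_clauses F. \<exists>(x, b)\<in>C. \<sigma> x = Some b)}"

text \<open>Indexing edge variables by unordered pairs gives \<open>X\<^sub>u\<^sub>,\<^sub>v = X\<^sub>v\<^sub>,\<^sub>u\<close>.\<close>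

datatype 'a gvar = VertexVar 'a | EdgeVar "'a set"

definition graph_cnf :: "'a ugraph \<Rightarrow> 'a gvar cnf" where
  "graph_cnf G =
     \<lparr>cnf_vars = VertexVar ` verts G \<union> EdgeVar ` edges G,
      cnf_clauses = {{(VertexVar u, True), (EdgeVar {u, v}, True), (VertexVar v, True)} | u v.
                       {u, v} \<in> edges G}\<rparr>"

text \<open>A node of the complete binary tree is encoded by the sequence of left/right turns leading
  to it from the root.\<close>

definition complete_binary_tree :: "nat \<Rightarrow> bool list ugraph" where
  "complete_binary_tree r =
     \<lparr>verts = {p. length p \<le> r},
      edges = {{p, p @ [b]} | p b. length p < r}\<rparr>"

lemma card_verts_complete_binary_tree:
  "card (verts (complete_binary_tree r)) = 2 ^ (r + 1) - 1"
proof -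
  have "card {p :: bool list. length p \<le> r} = (\<Sum>i\<le>r. 2 ^ i)"
    using card_lists_length_le[of "UNIV :: bool set" r] by simp
  also have "\<dots> = 2 ^ (r + 1) - 1"
    by (induction r) auto
  finally show ?thesis by (simp add: complete_binary_tree_def)
qed

text \<open>Each vertex \<open>a\<close> is replaced by the clique on \<open>{a} \<times> {..<k}\<close>.\<close>

definition clique_blowup :: "nat \<Rightarrow> 'a ugraph \<Rightarrow> ('a \<times> nat) ugraph" where
  "clique_blowup k G =
     \<lparr>verts = verts G \<times> {..<k},
      edges = {{(a, i), (a, j)} | a i j. a \<in> verts G \<and> i < k \<and> j < k \<and> i \<noteq> j}
            \<union> {{(a, i), (b, j)} | a b i j. {a, b} \<in> edges G \<and> i < k \<and> j < k}\<rparr>"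

definition CT :: "nat \<Rightarrow> nat \<Rightarrow> (bool list \<times> nat) ugraph" where
  "CT r k = clique_blowup k (complete_binary_tree r)"

definition F_CT :: "nat \<Rightarrow> nat \<Rightarrow> (bool list \<times> nat) gvar cnf" where
  "F_CT r k = graph_cnf (CT r k)"

text \<open>The outgoing edge of \<open>u\<close> labelled \<open>b\<close> leads to \<open>child B u b\<close>; the two edges of \<open>u\<close> may
  have the same head.  The values of \<open>var_of\<close> and \<open>child\<close> matter only at internal nodes.\<close>

record ('n, 'x) bdd =
  nodes :: "'n set"
  root :: 'n
  sink :: "bool \<Rightarrow> 'n"
  var_of :: "'n \<Rightarrow> 'x"
  child :: "'n \<Rightarrow> bool \<Rightarrow> 'n"

definition internal_nodes :: "('n, 'x) bdd \<Rightarrow> 'n set" where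
  "internal_nodes B = nodes B - range (sink B)"

definition bdd_arcs :: "('n, 'x) bdd \<Rightarrow> ('n \<times> 'n) set" where
  "bdd_arcs B = {(u, child B u b) | u b. u \<in> internal_nodes B}"

text \<open>\<open>bdd_path B u p w\<close>: there is a path from \<open>u\<close> to \<open>w\<close> along which exactly the list \<open>p\<close> of
  (variable, edge label) pairs is read.\<close>

fun bdd_path :: "('n, 'x) bdd \<Rightarrow> 'n \<Rightarrow> ('x \<times> bool) list \<Rightarrow> 'n \<Rightarrow> bool" where
  "bdd_path B u [] w \<longleftrightarrow> u = w"
| "bdd_path B u ((x, b) # p) w \<longleftrightarrow>
     u \<in> internal_nodes B \<and> var_of B u = x \<and> bdd_path B (child B u b) p w"

text \<open>Reachability from the root is required of internal nodes only: both sinks are always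
  present, but one of them is unreachable if the function is constant.\<close>

definition rooted_bdd :: "'x set \<Rightarrow> ('n, 'x) bdd \<Rightarrow> bool" where
  "rooted_bdd X B \<longleftrightarrow>
     finite (nodes B) \<and> root B \<in> nodes B \<and>
     range (sink B) \<subseteq> nodes B \<and> sink B True \<noteq> sink B False \<and>
     (\<forall>u\<in>internal_nodes B. var_of B u \<in> X \<and> (\<forall>b. child B u b \<in> nodes B)) \<and>
     acyclic (bdd_arcs B) \<and>
     (\<forall>u\<in>internal_nodes B. (root B, u) \<in> (bdd_arcs B)\<^sup>*)"

text \<open>Compliance with the order is strict, so no variable is read twice on a path.\<close>

definition is_obdd :: "'x set \<Rightarrow> 'x rel \<Rightarrow> ('n, 'x) bdd \<Rightarrow> bool" where
  "is_obdd X ord B \<longleftrightarrow>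
     rooted_bdd X B \<and> linear_order_on X ord \<and>
     (\<forall>p c. bdd_path B (root B) p (sink B c) \<longrightarrow>
        sorted_wrt (\<lambda>x y. x \<noteq> y \<and> (x, y) \<in> ord) (map fst p))"

text \<open>A path may skip variables; it then represents all assignments to \<open>X\<close> extending the partial
  assignment read along it.\<close>

definition accepted_assignments :: "'x set \<Rightarrow> ('n, 'x) bdd \<Rightarrow> ('x \<rightharpoonup> bool) set" where
  "accepted_assignments X B =
     {\<sigma>. dom \<sigma> = X \<and> (\<exists>p. bdd_path B (root B) p (sink B True) \<and> map_of p \<subseteq>\<^sub>m \<sigma>)}"

definition obdd_for :: "'x cnf \<Rightarrow> 'x rel \<Rightarrow> ('n, 'x) bdd \<Rightarrow> bool" where
  "obdd_for F ord B \<longleftrightarrow>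
     is_obdd (cnf_vars F) ord B \<and>
     accepted_assignments (cnf_vars F) B = sat_assignments F"

end

theory Submission
  imports Defs
begin

text \<open>
  A matching \<open>M\<close> between the vertices whose variables are among the first \<open>t\<close> in the order and the
  remaining vertices yields \<open>2 ^ card M\<close> subfunctions: set the edge variables of \<open>M\<close> to false and all
  others to true, so that the CNF becomes the conjunction of \<open>X\<^sub>u \<or> X\<^sub>v\<close> over \<open>M\<close>, and vary the values
  on the early side of \<open>M\<close>.  It thus suffices that every order of the vertices has a cut crossed by
  a matching of size \<open>k * \<lceil>r/2\<rceil>\<close>.

  If both sides of a cut contain at least \<open>k\<close> vertices of a connected part of the blown-up tree, then
  the cliques can be renumbered so that each of the \<open>k\<close> columns (copies of the tree) meets both
  sides, and each column contributes a crossing edge.  For the induction from height \<open>h\<close> to \<open>h + 2\<close>,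
  sort the critical times of three of the four grandchild subtrees.  At the middle time the middle
  subtree has its matching, the early subtree has \<open>k\<close> vertices before the cut and the late one has
  \<open>k\<close> after it, so the tree without the middle subtree supplies \<open>k\<close> further edges.
\<close>

section \<open>Cuts of an OBDD\<close>

lemma bdd_path_append:
  "bdd_path B u (p @ q) w \<longleftrightarrow> (\<exists>v. bdd_path B u p v \<and> bdd_path B v q w)"
  by (induction p arbitrary: u) auto

lemma bdd_path_in_nodes:
  assumes "rooted_bdd X B" "u \<in> nodes B" "bdd_path B u p w"
  shows "w \<in> nodes B"
  using assms(2,3)
proof (induction p arbitrary: u)
  case (Cons e p)
  obtain x b where "e = (x, b)" by force
  then show ?case
    using Cons assms(1) by (auto simp: rooted_bdd_def)
qed simp

lemma sorted_wrt_dropWhile_less: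
  fixes f :: "'a \<Rightarrow> 'b::linorder"
  assumes "sorted_wrt (\<lambda>x y. f (g x) < f (g y)) xs" "x \<in> set (dropWhile (\<lambda>x. f (g x) < t) xs)"
  shows "\<not> f (g x) < t"
  using assms by (induction xs) (auto split: if_splits)

text \<open>Cut the accepting path of each \<open>\<sigma> i\<close> at rank \<open>t\<close>,
  reaching a node \<open>n i\<close>. If \<open>n i = n j\<close>, swapping the tails gives two
  accepting paths, so both mixed assignments satisfy \<open>F\<close>. The fooling condition
  therefore makes \<open>n\<close> injective.\<close>

lemma obdd_fooling:
  fixes f :: "'x \<Rightarrow> nat"
  assumes obdd: "obdd_for F ord B"
    and mono: "\<And>x y. (x, y) \<in> ord \<Longrightarrow> x \<noteq> y \<Longrightarrow> f x < f y"
    and sat: "\<And>i. i \<in> I \<Longrightarrow> \<sigma> i \<in> sat_assignments F"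
    and fool: "\<And>i j. i \<in> I \<Longrightarrow> j \<in> I \<Longrightarrow> i \<noteq> j \<Longrightarrow>
        (\<lambda>x. if f x < t then \<sigma> i x else \<sigma> j x) \<notin> sat_assignments F \<or>
        (\<lambda>x. if f x < t then \<sigma> j x else \<sigma> i x) \<notin> sat_assignments F"
  shows "card I \<le> card (nodes B)"
proof -
  let ?X = "cnf_vars F"
  let ?P = "\<lambda>e. f (fst e) < t"
  have rooted: "rooted_bdd ?X B" and root: "root B \<in> nodes B" and fin: "finite (nodes B)"
    using obdd by (auto simp: obdd_for_def is_obdd_def rooted_bdd_def)
  have acc: "accepted_assignments ?X B = sat_assignments F"
    using obdd by (simp add: obdd_for_def)
  have "\<forall>i\<in>I. \<exists>p. bdd_path B (root B) p (sink B True) \<and> map_of p \<subseteq>\<^sub>m \<sigma> i"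
    using sat unfolding acc[symmetric] by (auto simp: accepted_assignments_def)
  then obtain p where p: "\<And>i. i \<in> I \<Longrightarrow> bdd_path B (root B) (p i) (sink B True)"
    "\<And>i. i \<in> I \<Longrightarrow> map_of (p i) \<subseteq>\<^sub>m \<sigma> i"
    by metis
  have agree: "\<sigma> i x = Some c" if "i \<in> I" "map_of (p i) x = Some c" for i x c
    using p(2)[OF that(1)] that(2) by (metis domI map_le_def)
  have dom: "dom (\<sigma> i) = ?X" if "i \<in> I" for i
    using sat[OF that] by (simp add: sat_assignments_def)
  \<comment> \<open>Ranks increase strictly along an accepting path, so \<open>a i\<close> collects
    all of its tests of rank below \<open>t\<close> and \<open>b i\<close> all the others.\<close>
  define a b where "a i = takeWhile ?P (p i)" and "b i = dropWhile ?P (p i)" for i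
  have ab: "p i = a i @ b i" for i
    by (simp add: a_def b_def)
  have "\<forall>i\<in>I. \<exists>v. bdd_path B (root B) (a i) v \<and> bdd_path B v (b i) (sink B True)"
    using p(1) by (metis ab bdd_path_append)
  then obtain n where n: "\<And>i. i \<in> I \<Longrightarrow> bdd_path B (root B) (a i) (n i)"
    "\<And>i. i \<in> I \<Longrightarrow> bdd_path B (n i) (b i) (sink B True)"
    by metis
  have early: "f x < t" if "map_of (a i) x = Some c" for i x c
    using map_of_SomeD[OF that] unfolding a_def by (auto dest: set_takeWhileD)
  have late: "\<not> f x < t" if "i \<in> I" "map_of (b i) x = Some c" for i x c
  proof -
    have "sorted_wrt (\<lambda>x y. x \<noteq> y \<and> (x, y) \<in> ord) (map fst (p i))"
      using obdd p(1)[OF that(1)] by (auto simp: obdd_for_def is_obdd_def)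
    then have "sorted_wrt (\<lambda>x y. f (fst x) < f (fst y)) (p i)"
      unfolding sorted_wrt_map by (rule sorted_wrt_mono_rel[rotated]) (auto intro: mono)
    then show ?thesis
      using sorted_wrt_dropWhile_less[of f fst "p i" "(x, c)" t] map_of_SomeD[OF that(2)]
      by (auto simp: b_def)
  qed
  have mix: "(\<lambda>x. if f x < t then \<sigma> i x else \<sigma> j x) \<in> sat_assignments F" (is "?\<tau> \<in> _")
    if ij: "i \<in> I" "j \<in> I" "n i = n j" for i j
  proof -
    have "bdd_path B (root B) (a i @ b j) (sink B True)"
      using n ij by (metis bdd_path_append)
    moreover have "map_of (a i @ b j) \<subseteq>\<^sub>m ?\<tau>"
    proof (unfold map_le_def, intro ballI)
      fix x assume "x \<in> dom (map_of (a i @ b j))"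
      then obtain c where c: "map_of (a i @ b j) x = Some c" by blast
      show "map_of (a i @ b j) x = ?\<tau> x"
      proof (cases "map_of (a i) x")
        case (Some d)
        then have "map_of (p i) x = Some d" by (simp add: ab map_add_def)
        then show ?thesis
          using Some early[OF Some] agree[OF ij(1)] by (simp add: map_add_def)
      next
        case None
        then have bj: "map_of (b j) x = Some c"
          using c by (simp add: map_add_def)
        \<comment> \<open>\<open>map_of\<close> prefers the earlier entry. As \<open>a j\<close>
          reads only ranks below \<open>t\<close>, it cannot override the value that
          \<open>b j\<close> reads at \<open>x\<close>.\<close>
        have "map_of (a j) x = None"
          using early late[OF ij(2) bj] by (cases "map_of (a j) x") auto
        then have "map_of (p j) x = Some c" using bj by (simp add: ab map_add_def)
        then show ?thesis
          using c late[OF ij(2) bj] agree[OF ij(2)] by simp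
      qed
    qed
    moreover have "dom ?\<tau> = ?X"
      using dom[OF ij(1)] dom[OF ij(2)] by (auto simp: dom_def split: if_splits)
    ultimately show ?thesis
      unfolding acc[symmetric] accepted_assignments_def by blast
  qed
  have "inj_on n I"
  proof (rule inj_onI, rule ccontr)
    fix i j assume "i \<in> I" "j \<in> I" "n i = n j" "i \<noteq> j"
    then show False
      using fool[of i j] mix[of i j] mix[of j i] by simp
  qed
  moreover have "n ` I \<subseteq> nodes B"
    using bdd_path_in_nodes[OF rooted root] n(1) by blast
  ultimately show ?thesis
    using fin by (rule card_inj_on_le)
qed

section \<open>Ranks of variables, and matchings as fooling sets\<close>

text \<open>The rank counts strict predecessors. If \<open>x\<close> strictly precedes
  \<open>y\<close>, transitivity gives inclusion of the predecessor sets, and \<open>x\<close>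
  itself makes it proper. Cuts of the order thus become numerical thresholds.\<close>

lemma linear_order_rank:
  assumes "linear_order_on X ord" "finite X"
  obtains f :: "'x \<Rightarrow> nat" where "\<And>x y. (x, y) \<in> ord \<Longrightarrow> x \<noteq> y \<Longrightarrow> f x < f y" "inj_on f X"
proof
  let ?f = "\<lambda>x. card {z. (z, x) \<in> ord \<and> z \<noteq> x}"
  have sub: "ord \<subseteq> X \<times> X" and tr: "trans ord" and as: "antisym ord" and tot: "total_on X ord"
    using assms(1)
    by (auto simp: linear_order_on_def partial_order_on_def preorder_on_def)
  show *: "?f x < ?f y" if "(x, y) \<in> ord" "x \<noteq> y" for x y
  proof (rule psubset_card_mono)
    show "finite {z. (z, y) \<in> ord \<and> z \<noteq> y}"
      by (rule finite_subset[OF _ assms(2)]) (use sub in auto)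
    show "{z. (z, x) \<in> ord \<and> z \<noteq> x} \<subset> {z. (z, y) \<in> ord \<and> z \<noteq> y}"
      using that tr as by (auto simp: trans_def antisym_def)
  qed
  show "inj_on ?f X"
  proof (rule inj_onI, rule ccontr)
    fix x y assume "x \<in> X" "y \<in> X" "?f x = ?f y" "x \<noteq> y"
    then show False
      using tot *[of x y] *[of y x] by (auto simp: total_on_def)
  qed
qed

text \<open>Each subset of \<open>M\<close> selects which endpoint of every matching edge is true.
  For two distinct subsets, one of the two mixtures across the cut makes both endpoints of some
  matching edge false, so \<open>Pow M\<close> indexes a fooling set.\<close>

lemma graph_cnf_matching_bound:
  fixes G :: "'a ugraph" and f :: "'a gvar \<Rightarrow> nat"
  assumes obdd: "obdd_for (graph_cnf G) ord B"
    and mono: "\<And>x y. (x, y) \<in> ord \<Longrightarrow> x \<noteq> y \<Longrightarrow> f x < f y"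
    and M: "finite M" "inj_on fst M" "inj_on snd M"
    and crossing: "\<And>u v. (u, v) \<in> M \<Longrightarrow> {u, v} \<in> edges G \<and> u \<in> verts G \<and> v \<in> verts G \<and>
        f (VertexVar u) < t \<and> \<not> f (VertexVar v) < t"
  shows "2 ^ card M \<le> card (nodes B)"
proof -
  let ?F = "graph_cnf G"
  \<comment> \<open>For \<open>(u, v)\<close> in \<open>M\<close>, membership in \<open>S\<close>
    makes \<open>u\<close> true and \<open>v\<close> false, non-membership the reverse. Edge
    variables get the same value for every \<open>S\<close>, so it is irrelevant on which side of
    the cut they lie.\<close>
  define bit where "bit S x = (case x of
      VertexVar w \<Rightarrow> \<not> (\<exists>(u, v)\<in>M. w = u \<and> (u, v) \<notin> S \<or> w = v \<and> (u, v) \<in> S)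
    | EdgeVar e \<Rightarrow> e \<notin> (\<lambda>(u, v). {u, v}) ` M)" for S x
  define \<sigma> where "\<sigma> S x = (if x \<in> cnf_vars ?F then Some (bit S x) else None)" for S x
  have vars: "VertexVar u \<in> cnf_vars ?F" "VertexVar v \<in> cnf_vars ?F" "EdgeVar {u, v} \<in> cnf_vars ?F"
    if "(u, v) \<in> M" for u v
    using crossing[OF that] by (auto simp: graph_cnf_def)
  \<comment> \<open>The cut separates first from second components, so injectivity of both
    projections makes \<open>M\<close> a genuine matching: no vertex gets conflicting values from
    two pairs.\<close>
  have uniq: "u = u' \<longleftrightarrow> v = v'" "u \<noteq> v'" "v \<noteq> u'"
    if "(u, v) \<in> M" "(u', v') \<in> M" for u v u' v'
    using that inj_onD[OF M(2), of "(u, v)" "(u', v')"] inj_onD[OF M(3), of "(u, v)" "(u', v')"]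
      crossing[OF that(1)] crossing[OF that(2)] by auto
  have sat: "\<sigma> S \<in> sat_assignments ?F" for S
  proof -
    have "\<exists>(x, b)\<in>C. \<sigma> S x = Some b" if C: "C \<in> cnf_clauses ?F" for C
    proof -
      obtain x y where xy: "{x, y} \<in> edges G"
        and C_eq: "C = {(VertexVar x, True), (EdgeVar {x, y}, True), (VertexVar y, True)}"
        using C by (auto simp: graph_cnf_def)
      show ?thesis
      proof (cases "{x, y} \<in> (\<lambda>(u, v). {u, v}) ` M")
        case False
        then have "\<sigma> S (EdgeVar {x, y}) = Some True"
          using xy by (simp add: \<sigma>_def bit_def graph_cnf_def)
        then show ?thesis by (auto simp: C_eq)
      next
        case True
        then obtain u v where uv: "(u, v) \<in> M" "{x, y} = {u, v}" by auto
        have "bit S (VertexVar (if (u, v) \<in> S then u else v))"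
          using uv(1) uniq unfolding bit_def by (auto dest: uniq)
        then have "\<sigma> S (VertexVar (if (u, v) \<in> S then u else v)) = Some True"
          using vars[OF uv(1)] by (simp add: \<sigma>_def)
        then show ?thesis
          using uv(2) by (auto simp: C_eq doubleton_eq_iff split: if_splits)
      qed
    qed
    then show ?thesis
      by (auto simp: sat_assignments_def \<sigma>_def dom_def)
  qed
  have violated: "(\<lambda>x. if f x < t then \<sigma> S' x else \<sigma> S x) \<notin> sat_assignments ?F" (is "?\<tau> \<notin> _")
    if uv: "(u, v) \<in> M" and S: "(u, v) \<in> S" "(u, v) \<notin> S'" for u v S S'
  proof
    assume "?\<tau> \<in> sat_assignments ?F"
    moreover have "{(VertexVar u, True), (EdgeVar {u, v}, True), (VertexVar v, True)} \<in> cnf_clauses ?F"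
      using crossing[OF uv] by (auto simp: graph_cnf_def)
    ultimately have "?\<tau> (VertexVar u) = Some True \<or> ?\<tau> (EdgeVar {u, v}) = Some True \<or>
        ?\<tau> (VertexVar v) = Some True"
      by (force simp: sat_assignments_def)
    moreover have "?\<tau> (VertexVar u) = Some False"
      using crossing[OF uv] vars[OF uv] uv S by (auto simp: \<sigma>_def bit_def)
    moreover have "?\<tau> (VertexVar v) = Some False"
      using crossing[OF uv] vars[OF uv] uv S by (auto simp: \<sigma>_def bit_def)
    moreover have "?\<tau> (EdgeVar {u, v}) = Some False"
      using vars[OF uv] uv by (force simp: \<sigma>_def bit_def)
    ultimately show False by simp
  qed
  have "card (Pow M) \<le> card (nodes B)"
  proof (rule obdd_fooling[OF obdd mono sat, where t = t])
    fix S S' assume "S \<in> Pow M" "S' \<in> Pow M" "S \<noteq> S'"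
    \<comment> \<open>Which of the two subsets contains \<open>e\<close> decides which of the two
      mixtures is falsified.\<close>
    then obtain e where "e \<in> M" "e \<in> S \<and> e \<notin> S' \<or> e \<in> S' \<and> e \<notin> S" by blast
    then show "(\<lambda>x. if f x < t then \<sigma> S x else \<sigma> S' x) \<notin> sat_assignments ?F \<or>
        (\<lambda>x. if f x < t then \<sigma> S' x else \<sigma> S x) \<notin> sat_assignments ?F"
      using violated[of "fst e" "snd e"] by (metis prod.collapse)
  qed
  then show ?thesis by (simp add: card_Pow M(1))
qed

section \<open>Balanced renumbering of the cliques\<close>

text \<open>Greedy load balancing: each new subset first takes columns of the lower load
  \<open>q\<close>, and takes fuller ones only once all columns in \<open>L\<close> are used. The
  loads then stay in \<open>{q, Suc q}\<close> or move up to the next such pair.\<close>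

lemma balanced_subsets:
  assumes "finite S" "\<And>s. s \<in> S \<Longrightarrow> \<alpha> s \<le> k"
  shows "\<exists>P q. (\<forall>s\<in>S. P s \<subseteq> {..<k} \<and> card (P s) = \<alpha> s) \<and>
           (\<forall>j<k. card {s \<in> S. j \<in> P s} \<in> {q, Suc q})"
  using assms
proof (induction S)
  case empty
  show ?case by (intro exI[of _ "\<lambda>_. {}"] exI[of _ 0]) simp
next
  case (insert x S)
  then obtain P q where P: "\<And>s. s \<in> S \<Longrightarrow> P s \<subseteq> {..<k} \<and> card (P s) = \<alpha> s"
    and q: "\<And>j. j < k \<Longrightarrow> card {s \<in> S. j \<in> P s} \<in> {q, Suc q}"
    by (metis insertCI)
  define L where "L = {j. j < k \<and> card {s \<in> S. j \<in> P s} = q}"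
  have L: "finite L" "L \<subseteq> {..<k}" by (auto simp: L_def)
  obtain R where R: "R \<subseteq> {..<k}" "card R = \<alpha> x" "R \<subseteq> L \<or> L \<subseteq> R"
  proof (cases "\<alpha> x \<le> card L")
    case True
    then obtain R where R: "R \<subseteq> L" "card R = \<alpha> x"
      using obtain_subset_with_card_n by metis
    then have "R \<subseteq> {..<k}" using L(2) by simp
    then show ?thesis using R that by simp
  next
    case False
    have "\<alpha> x \<le> card {..<k}" using insert.prems[of x] by simp
    moreover have "card L \<le> \<alpha> x" using False by simp
    ultimately obtain R where "L \<subseteq> R" "R \<subseteq> {..<k}" "card R = \<alpha> x"
      using exists_subset_between[OF _ _ L(2)] by (metis finite_lessThan)
    then show ?thesis using that by simp
  qed
  have count: "card {s \<in> insert x S. j \<in> (P(x := R)) s} =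
      card {s \<in> S. j \<in> P s} + (if j \<in> R then 1 else 0)" for j
  proof -
    have "{s \<in> insert x S. j \<in> (P(x := R)) s} =
        (if j \<in> R then insert x {s \<in> S. j \<in> P s} else {s \<in> S. j \<in> P s})"
      using insert.hyps by auto
    then show ?thesis using insert.hyps by simp
  qed
  have "\<exists>q'. \<forall>j<k. card {s \<in> S. j \<in> P s} + (if j \<in> R then 1 else 0) \<in> {q', Suc q'}"
    using R(3)
  proof
    assume "R \<subseteq> L"
    then show ?thesis
      using q by (intro exI[of _ q]) (auto simp: L_def)
  next
    assume "L \<subseteq> R"
    then show ?thesis
      using q by (intro exI[of _ "Suc q"]) (auto simp: L_def)
  qed
  then have "\<exists>q'. \<forall>j<k. card {s \<in> insert x S. j \<in> (P(x := R)) s} \<in> {q', Suc q'}"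
    unfolding count .
  moreover have "\<forall>s\<in>insert x S. (P(x := R)) s \<subseteq> {..<k} \<and> card ((P(x := R)) s) = \<alpha> s"
    using P R insert.hyps by auto
  ultimately show ?case by blast
qed

text \<open>Permute every row so that the members of \<open>A\<close> are spread evenly over the
  columns. Column counts then differ by at most one, so an average of at least one member of
  \<open>A\<close> per column leaves no column without one; the same holds for the
  complement.\<close>

lemma mixed_columns:
  fixes A :: "('s \<times> nat) set"
  assumes S: "finite S"
    and A: "k \<le> card (S \<times> {..<k} \<inter> A)" and B: "k \<le> card (S \<times> {..<k} - A)"
  obtains c :: "'s \<Rightarrow> nat \<Rightarrow> nat" where
    "\<And>s. s \<in> S \<Longrightarrow> inj_on (c s) {..<k}" "\<And>s j. s \<in> S \<Longrightarrow> j < k \<Longrightarrow> c s j < k"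
    "\<And>j. j < k \<Longrightarrow> (\<exists>s\<in>S. (s, c s j) \<in> A) \<and> (\<exists>s\<in>S. (s, c s j) \<notin> A)"
proof -
  define Q where "Q s = {i. i < k \<and> (s, i) \<in> A}" for s
  have Q: "Q s \<subseteq> {..<k}" "finite (Q s)" for s by (auto simp: Q_def)
  have "card (Q s) \<le> k" for s using card_mono[OF _ Q(1)[of s]] by simp
  then obtain P q where P: "\<And>s. s \<in> S \<Longrightarrow> P s \<subseteq> {..<k} \<and> card (P s) = card (Q s)"
    and q: "\<And>j. j < k \<Longrightarrow> card {s \<in> S. j \<in> P s} \<in> {q, Suc q}"
    using balanced_subsets[OF S, of "\<lambda>s. card (Q s)" k] by blast
  have "\<forall>s\<in>S. \<exists>g. bij_betw g {..<k} {..<k} \<and> g ` P s = Q s"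
  proof
    fix s assume "s \<in> S"
    note Ps = P[OF this]
    have fin: "finite (P s)" using Ps finite_subset by blast
    obtain g where g: "bij_betw g (P s) (Q s)"
      using finite_same_card_bij[OF fin Q(2)] Ps by metis
    \<comment> \<open>The complements also have equal size, so the bijection from \<open>P s\<close>
      to \<open>Q s\<close> extends to a permutation of \<open>{..<k}\<close>.\<close>
    have "card ({..<k} - P s) = card ({..<k} - Q s)"
      using Ps Q fin by (simp add: card_Diff_subset)
    then obtain g' where g': "bij_betw g' ({..<k} - P s) ({..<k} - Q s)"
      using finite_same_card_bij[of "{..<k} - P s" "{..<k} - Q s"] by auto
    let ?g = "\<lambda>j. if j \<in> P s then g j else g' j"
    have "bij_betw ?g (P s \<union> ({..<k} - P s)) (Q s \<union> ({..<k} - Q s))"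
      by (rule bij_betw_disjoint_Un[OF g g']) auto
    moreover have "P s \<union> ({..<k} - P s) = {..<k}" "Q s \<union> ({..<k} - Q s) = {..<k}"
      using Ps Q(1)[of s] by auto
    moreover have "?g ` P s = Q s"
      using g by (auto simp: bij_betw_def)
    ultimately show "\<exists>g. bij_betw g {..<k} {..<k} \<and> g ` P s = Q s" by metis
  qed
  then obtain c where c: "\<And>s. s \<in> S \<Longrightarrow> bij_betw (c s) {..<k} {..<k}"
    "\<And>s. s \<in> S \<Longrightarrow> c s ` P s = Q s"
    by metis
  have lt: "c s j < k" if "s \<in> S" "j < k" for s j
    using bij_betwE[OF c(1)[OF that(1)]] that by auto
  have inj: "inj_on (c s) {..<k}" if "s \<in> S" for s
    using c(1)[OF that] by (simp add: bij_betw_def)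
  have mem: "(s, c s j) \<in> A \<longleftrightarrow> j \<in> P s" if "s \<in> S" "j < k" for s j
  proof -
    have "(s, c s j) \<in> A \<longleftrightarrow> c s j \<in> c s ` P s"
      using lt[OF that] c(2)[OF that(1)] by (simp add: Q_def)
    also have "\<dots> \<longleftrightarrow> j \<in> P s"
      using inj_on_image_mem_iff[OF inj[OF that(1)]] P[OF that(1)] that by auto
    finally show ?thesis .
  qed
  let ?N = "\<lambda>j. card {s \<in> S. j \<in> P s}"
  have "(\<Sum>j<k. ?N j) = (\<Sum>j<k. \<Sum>s\<in>S. if j \<in> P s then 1 else 0)"
    by (rule sum.cong) (use S in \<open>auto simp: sum.If_cases Int_def\<close>)
  also have "\<dots> = (\<Sum>s\<in>S. \<Sum>j<k. if j \<in> P s then 1 else 0)"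
    by (rule sum.swap)
  also have "\<dots> = (\<Sum>s\<in>S. card (P s))"
    by (rule sum.cong) (use P in \<open>auto simp: sum.If_cases Int_absorb1\<close>)
  also have "\<dots> = (\<Sum>s\<in>S. card (Q s))"
    using P by simp
  also have "\<dots> = card (SIGMA s:S. Q s)"
    using S Q by simp
  also have "(SIGMA s:S. Q s) = S \<times> {..<k} \<inter> A"
    by (auto simp: Q_def)
  finally have total: "(\<Sum>j<k. ?N j) = card (S \<times> {..<k} \<inter> A)" .
  have total': "(\<Sum>j<k. ?N j) + k \<le> card S * k"
  proof -
    have "card (S \<times> {..<k}) = card (S \<times> {..<k} \<inter> A) + card (S \<times> {..<k} - A)"
      by (rule card_Int_Diff) (use S in simp)
    then show ?thesis using B total by (simp add: card_cartesian_product)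
  qed
  have "(\<exists>s\<in>S. (s, c s j) \<in> A) \<and> (\<exists>s\<in>S. (s, c s j) \<notin> A)" if j: "j < k" for j
  proof
    show "\<exists>s\<in>S. (s, c s j) \<in> A"
    proof (rule ccontr)
      assume "\<not> ?thesis"
      then have j0: "{s \<in> S. j \<in> P s} = {}" using mem j by auto
      \<comment> \<open>One empty column bounds all counts by 1, so the total drops below
        \<open>k\<close>.\<close>
      have "q = 0" using q[OF j] unfolding j0 by simp
      then have "?N i \<le> 1" if "i < k" for i using q[OF that] by auto
      moreover have "?N j < 1" by (simp only: j0) simp
      ultimately have "(\<Sum>i<k. ?N i) < (\<Sum>i<k. 1)"
        using j by (intro sum_strict_mono_ex1) auto
      then show False using A total by simp
    qed
    show "\<exists>s\<in>S. (s, c s j) \<notin> A"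
    proof (rule ccontr)
      assume "\<not> ?thesis"
      then have "{s \<in> S. j \<in> P s} = S" using mem j by auto
      then have jS: "?N j = card S" by simp
      \<comment> \<open>One full column forces all counts to be at least \<open>card S - 1\<close>,
        and its own is larger, contradicting \<open>total'\<close>. The subtraction is not
        truncated: \<open>card S = 0\<close> would contradict \<open>total'\<close> and
        \<open>j < k\<close>.\<close>
      then have "card S - 1 \<le> ?N i" if "i < k" for i using q[OF that] q[OF j] by auto
      moreover have "card S - 1 < ?N j"
        using total' j jS by (cases "card S") auto
      ultimately have "(\<Sum>i<k. card S - 1) < (\<Sum>i<k. ?N i)"
        using j by (intro sum_strict_mono_ex1) auto
      then show False
        using total' j by (cases "card S") (simp_all add: mult.commute)
    qed
  qed
  then show thesis using that inj lt by blast
qed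

section \<open>Matchings across a cut\<close>

text \<open>Pairs are oriented from \<open>A\<close> to its complement. Only edges between cliques
  of adjacent tree nodes occur; the clique indices are unconstrained because such cliques are
  completely joined.\<close>

definition cut_matching ::
    "nat \<Rightarrow> bool list set \<Rightarrow> (bool list \<times> nat) set \<Rightarrow> ((bool list \<times> nat) \<times> (bool list \<times> nat)) set \<Rightarrow> bool"
  where
  "cut_matching k S A M \<longleftrightarrow>
     M \<subseteq> (S \<times> {..<k} \<inter> A) \<times> (S \<times> {..<k} - A) \<and> inj_on fst M \<and> inj_on snd M \<and>
     (\<forall>(u, v)\<in>M. \<exists>b. fst v = fst u @ [b] \<or> fst u = fst v @ [b])"

definition subtree :: "bool list \<Rightarrow> nat \<Rightarrow> bool list set" where
  "subtree q h = {q @ p | p. length p \<le> h}"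

lemma finite_subtree [simp]: "finite (subtree q h)"
proof -
  have "subtree q h = (@) q ` {p. length p \<le> h}" by (auto simp: subtree_def)
  then show ?thesis
    using finite_lists_length_le[of "UNIV :: bool set" h] by simp
qed

text \<open>In the induction this converts the matching of a subtree into at least \<open>k\<close>
  vertices on either side of its own cut.\<close>

lemma cut_matching_sides:
  assumes "cut_matching k S A M" "finite S"
  shows "card M \<le> card (S \<times> {..<k} \<inter> A)" "card M \<le> card (S \<times> {..<k} - A)"
proof -
  have "fst ` M \<subseteq> S \<times> {..<k} \<inter> A" "snd ` M \<subseteq> S \<times> {..<k} - A"
    using assms(1) unfolding cut_matching_def by fastforce+
  moreover have "inj_on fst M" "inj_on snd M"
    using assms(1) by (auto simp: cut_matching_def)
  moreover have "finite (S \<times> {..<k} \<inter> A)" "finite (S \<times> {..<k} - A)"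
    using assms(2) by simp_all
  ultimately show "card M \<le> card (S \<times> {..<k} \<inter> A)" "card M \<le> card (S \<times> {..<k} - A)"
    by (metis card_inj_on_le)+
qed

lemma cut_matching_Un:
  assumes "cut_matching k S A M" "cut_matching k S' A M'" "S \<inter> S' = {}"
  shows "cut_matching k (S \<union> S') A (M \<union> M')"
proof -
  have "fst ` M \<inter> fst ` M' = {}" "snd ` M \<inter> snd ` M' = {}"
    using assms unfolding cut_matching_def by fastforce+
  then show ?thesis
    using assms(1,2) unfolding cut_matching_def by (auto simp: inj_on_Un)
qed

text \<open>After renumbering, each column is a copy of \<open>S\<close> that meets both sides.
  Closure under parents down to \<open>q\<close> makes \<open>S\<close> connected, so every column
  has a tree edge that changes sides.\<close>

lemma cut_matching_connected:
  assumes S: "finite S" "\<And>s. s \<in> S \<Longrightarrow> \<exists>p. s = q @ p"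
    and closed: "\<And>p b. q @ p @ [b] \<in> S \<Longrightarrow> q @ p \<in> S"
    and A: "k \<le> card (S \<times> {..<k} \<inter> A)" and B: "k \<le> card (S \<times> {..<k} - A)"
  obtains M where "cut_matching k S A M" "card M = k"
proof -
  obtain c where c: "\<And>s. s \<in> S \<Longrightarrow> inj_on (c s) {..<k}" "\<And>s j. s \<in> S \<Longrightarrow> j < k \<Longrightarrow> c s j < k"
    "\<And>j. j < k \<Longrightarrow> (\<exists>s\<in>S. (s, c s j) \<in> A) \<and> (\<exists>s\<in>S. (s, c s j) \<notin> A)"
    using mixed_columns[OF S(1) A B] by metis
  have "\<exists>s\<in>S. \<exists>s'\<in>S. (s, c s j) \<in> A \<and> (s', c s' j) \<notin> A \<and> (\<exists>b. s' = s @ [b] \<or> s = s' @ [b])"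
    if j: "j < k" for j
  proof (rule ccontr)
    assume *: "\<not> ?thesis"
    \<comment> \<open>Without a crossing edge, membership in \<open>A\<close> propagates from
      \<open>q\<close> to the whole column \<open>j\<close>.\<close>
    have "q @ p \<in> S \<Longrightarrow> (q @ p, c (q @ p) j) \<in> A \<longleftrightarrow> (q, c q j) \<in> A" for p
    proof (induction p rule: rev_induct)
      case (snoc b p)
      have "q @ p \<in> S" using closed snoc.prems by simp
      with snoc * show ?case by (metis append_assoc)
    qed simp
    then have "(s, c s j) \<in> A \<longleftrightarrow> (q, c q j) \<in> A" if "s \<in> S" for s
      using S(2)[OF that] that by blast
    then show False using c(3)[OF j] by blast
  qed
  then obtain s s' where s: "\<And>j. j < k \<Longrightarrow> s j \<in> S \<and> s' j \<in> S \<and> (s j, c (s j) j) \<in> A \<and>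
      (s' j, c (s' j) j) \<notin> A \<and> (\<exists>b. s' j = s j @ [b] \<or> s j = s' j @ [b])"
    by metis
  define e where "e j = ((s j, c (s j) j), (s' j, c (s' j) j))" for j
  \<comment> \<open>A shared endpoint lies in a single row \<open>s\<close>, where
    \<open>c s\<close> is injective, so the columns coincide.\<close>
  have inj: "i = j" if "i < k" "j < k" "fst (e i) = fst (e j) \<or> snd (e i) = snd (e j)" for i j
    using that s[of i] s[of j] c(1)[of "s j"] c(1)[of "s' j"] by (auto simp: e_def inj_on_def)
  have "inj_on e {..<k}" using inj by (auto simp: inj_on_def)
  then have "card (e ` {..<k}) = k" by (simp add: card_image)
  moreover have "cut_matching k S A (e ` {..<k})"
    unfolding cut_matching_def
  proof (intro conjI)
    show "e ` {..<k} \<subseteq> (S \<times> {..<k} \<inter> A) \<times> (S \<times> {..<k} - A)"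
      using s c(2) by (auto simp: e_def)
    show "inj_on fst (e ` {..<k})" "inj_on snd (e ` {..<k})"
      using inj by (force simp: inj_on_def)+
    show "\<forall>(u, v)\<in>e ` {..<k}. \<exists>b. fst v = fst u @ [b] \<or> fst u = fst v @ [b]"
      using s by (auto simp: e_def)
  qed
  ultimately show thesis using that by blast
qed

section \<open>Choice of the cut by induction on the height\<close>

text \<open>A discrete intermediate value argument: the count starts at 0 and, by injectivity of
  \<open>f\<close>, grows by at most one per step, so the least \<open>t\<close> reaching
  \<open>n\<close> attains it exactly.\<close>

lemma exists_cut_of_card:
  fixes f :: "'a \<Rightarrow> nat"
  assumes "finite V" "inj_on f V" "n \<le> card V"
  obtains t where "card (V \<inter> {v. f v < t}) = n"
proof -
  let ?c = "\<lambda>t. card (V \<inter> {v. f v < t})"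
  have step: "?c (Suc t) \<le> Suc (?c t)" for t
  proof -
    have sub: "V \<inter> {v. f v < Suc t} \<subseteq> V \<inter> {v. f v < t} \<union> V \<inter> f -` {t}" by auto
    have "card (V \<inter> f -` {t}) \<le> card {t}"
      by (rule card_inj_on_le[of f]) (use assms(2) in \<open>auto simp: inj_on_def\<close>)
    then show ?thesis
      using card_mono[OF _ sub] card_Un_le[of "V \<inter> {v. f v < t}" "V \<inter> f -` {t}"] assms(1) by auto
  qed
  have "V \<inter> {v. f v < Suc (Max (f ` V))} = V"
    using assms(1) by (auto simp: less_Suc_eq_le)
  then have ex: "n \<le> ?c (Suc (Max (f ` V)))" using assms(3) by simp
  define t where "t = (LEAST t. n \<le> ?c t)"
  have t: "n \<le> ?c t" using ex unfolding t_def by (rule LeastI)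
  have "?c t \<le> n"
  proof (cases t)
    case (Suc t')
    then have "\<not> n \<le> ?c t'" unfolding t_def using not_less_Least by (metis lessI)
    then show ?thesis using step[of t'] Suc by simp
  qed simp
  then show thesis using t that by (meson le_antisym)
qed

lemma card_subtree_ge:
  assumes "h \<ge> 1"
  shows "2 \<le> card (subtree q h)"
proof -
  have "{q, q @ [True]} \<subseteq> subtree q h" using assms by (auto simp: subtree_def)
  from card_mono[OF finite_subtree this] show ?thesis by simp
qed

lemma middle_of_three:
  fixes \<tau> :: "'a \<Rightarrow> 'b::linorder" and x y z :: 'a
  assumes "x \<noteq> y" "y \<noteq> z" "x \<noteq> z"
  obtains x' y' z' where "{x', y', z'} = {x, y, z}" "x' \<noteq> y'" "y' \<noteq> z'" "\<tau> x' \<le> \<tau> y'" "\<tau> y' \<le> \<tau> z'"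
proof -
  consider "\<tau> x \<le> \<tau> y \<and> \<tau> y \<le> \<tau> z" | "\<tau> x \<le> \<tau> z \<and> \<tau> z \<le> \<tau> y" | "\<tau> y \<le> \<tau> x \<and> \<tau> x \<le> \<tau> z"
    | "\<tau> y \<le> \<tau> z \<and> \<tau> z \<le> \<tau> x" | "\<tau> z \<le> \<tau> x \<and> \<tau> x \<le> \<tau> y" | "\<tau> z \<le> \<tau> y \<and> \<tau> y \<le> \<tau> x"
    by (meson linear)
  then show thesis
    by cases (use that[of x y z] that[of x z y] that[of y x z] that[of y z x] that[of z x y]
        that[of z y x] assms in auto)
qed

lemma subtree_cut_matching:
  fixes f :: "bool list \<times> nat \<Rightarrow> nat"
  assumes "inj_on f (subtree q h \<times> {..<k})"
  shows "\<exists>t M. cut_matching k (subtree q h) {v. f v < t} M \<and> card M = k * ((h + 1) div 2)"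
  using assms
proof (induction h arbitrary: q rule: less_induct)
  case (less h)
  \<comment> \<open>Height 2 is a base case because the inductive step needs
    \<open>h' \<ge> 1\<close>: only then do the grandchild matchings have at least \<open>k\<close>
    edges.\<close>
  consider "h = 0" | "h = 1 \<or> h = 2" | h' where "h' \<ge> 1" "h = Suc (Suc h')"
    by (cases h; cases "h - 1"; cases "h - 2") auto
  then show ?case
  proof cases
    case 1
    then show ?thesis
      by (intro exI[of _ 0] exI[of _ "{}"]) (simp add: cut_matching_def)
  next
    case 2
    let ?V = "subtree q h \<times> {..<k}"
    have V: "finite ?V" by simp
    \<comment> \<open>With at least two cliques, a cut after exactly \<open>k\<close> vertices
      leaves \<open>k\<close> or more behind it.\<close>
    have ge: "2 * k \<le> card ?V"
      using card_subtree_ge[of h q] 2 by (auto simp: card_cartesian_product)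
    then have "k \<le> card ?V" by linarith
    then obtain t where t: "card (?V \<inter> {v. f v < t}) = k"
      using exists_cut_of_card[OF V less.prems] by metis
    have "card ?V = k + card (?V - {v. f v < t})"
      using card_Int_Diff[OF V, of "{v. f v < t}"] t by simp
    then have "k \<le> card (?V - {v. f v < t})" using ge by simp
    moreover have "\<exists>p. s = q @ p" if "s \<in> subtree q h" for s
      using that by (auto simp: subtree_def)
    moreover have "q @ p \<in> subtree q h" if "q @ p @ [b] \<in> subtree q h" for p b
      using that by (auto simp: subtree_def)
    ultimately obtain M where "cut_matching k (subtree q h) {v. f v < t} M" "card M = k"
      using cut_matching_connected[OF finite_subtree] t by (metis order_refl)
    moreover have "(h + 1) div 2 = 1" using 2 by auto
    ultimately show ?thesis by auto
  next
    case 3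
    let ?T = "\<lambda>(a, b). subtree (q @ [a, b]) h'"
    have sub: "?T x \<subseteq> subtree q h" for x
      using 3 by (force simp: subtree_def split: prod.split)
    have disj: "?T x \<inter> ?T y = {}" if "x \<noteq> y" for x y
      using that by (auto simp: subtree_def split: prod.split)
    have "\<exists>t M. cut_matching k (?T x) {v. f v < t} M \<and> card M = k * ((h' + 1) div 2)" for x
    proof -
      obtain a b where x: "x = (a, b)" by force
      have "inj_on f (?T x \<times> {..<k})"
        by (rule inj_on_subset[OF less.prems]) (use sub[of x] in auto)
      then show ?thesis
        using less.IH[of h' "q @ [a, b]"] 3 by (simp add: x)
    qed
    then obtain \<tau> M where M: "\<And>x. cut_matching k (?T x) {v. f v < \<tau> x} (M x)"
      "\<And>x. card (M x) = k * ((h' + 1) div 2)"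
      by metis
    have "(False, False) \<noteq> (False, True)" "(False, True) \<noteq> (True, False)"
      "(False, False) \<noteq> (True, False)"
      by simp_all
    from middle_of_three[OF this, of \<tau>]
    obtain x y z where "{x, y, z} = {(False, False), (False, True), (True, False)}"
      and xyz: "x \<noteq> y" "y \<noteq> z" "\<tau> x \<le> \<tau> y" "\<tau> y \<le> \<tau> z" .
    define A where "A = {v. f v < \<tau> y}"
    define S where "S = subtree q h - ?T y"
    have finT: "finite (?T x)" for x by (simp split: prod.split)
    have finS: "finite S" by (simp add: S_def)
    have SxSz: "?T x \<subseteq> S" "?T z \<subseteq> S"
      using sub disj[OF xyz(1)] disj[OF xyz(2)] by (auto simp: S_def)
    have "1 \<le> (h' + 1) div 2" using 3(1) by linarith
    then have big: "k \<le> card (M w)" for w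
      unfolding M(2) using mult_le_mono2[of 1 _ k] by simp
    \<comment> \<open>Vertices before the cut at \<open>\<tau> x\<close> are also before the later
      cut at \<open>\<tau> y\<close>; dually, those after \<open>\<tau> z\<close> are after
      \<open>\<tau> y\<close>.\<close>
    have "k \<le> card (S \<times> {..<k} \<inter> A)"
    proof -
      have "k \<le> card (?T x \<times> {..<k} \<inter> {v. f v < \<tau> x})"
        using cut_matching_sides(1)[OF M(1) finT] big le_trans by blast
      also have "\<dots> \<le> card (S \<times> {..<k} \<inter> A)"
        by (rule card_mono) (use finS SxSz xyz in \<open>auto simp: A_def\<close>)
      finally show ?thesis .
    qed
    moreover have "k \<le> card (S \<times> {..<k} - A)"
    proof -
      have "k \<le> card (?T z \<times> {..<k} - {v. f v < \<tau> z})"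
        using cut_matching_sides(2)[OF M(1) finT] big le_trans by blast
      also have "\<dots> \<le> card (S \<times> {..<k} - A)"
        by (rule card_mono) (use finS SxSz xyz in \<open>auto simp: A_def\<close>)
      finally show ?thesis .
    qed
    \<comment> \<open>The removed part contains all descendants of its nodes within the height
      bound, so parents of remaining nodes remain.\<close>
    moreover have "q @ p \<in> S" if "q @ p @ [b] \<in> S" for p b
      using that 3 by (auto simp: S_def subtree_def split: prod.splits)
    moreover have "\<exists>p. s = q @ p" if "s \<in> S" for s
      using that by (auto simp: S_def subtree_def)
    ultimately obtain N where N: "cut_matching k S A N" "card N = k"
      using cut_matching_connected[OF finS] by metis
    have My: "cut_matching k (?T y) A (M y)" using M(1) by (simp add: A_def)
    have "cut_matching k (S \<union> ?T y) A (N \<union> M y)"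
      by (rule cut_matching_Un[OF N(1) My]) (simp add: S_def Int_commute)
    moreover have "S \<union> ?T y = subtree q h" using sub by (auto simp: S_def)
    moreover have "card (N \<union> M y) = k * ((h + 1) div 2)"
    proof -
      have "finite N" "finite (M y)"
        using N(1) My finS finT unfolding cut_matching_def
        by (meson finite_Diff finite_Int finite_SigmaI finite_lessThan finite_subset)+
      moreover have "N \<inter> M y = {}"
        using N(1) My unfolding cut_matching_def S_def by fastforce
      ultimately show ?thesis
        using N(2) M(2)[of y] 3(2) by (simp add: card_Un_disjoint)
    qed
    ultimately show ?thesis unfolding A_def by metis
  qed
qed

theorem theorem1:
  fixes r k :: nat
    and ord :: "(bool list \<times> nat) gvar rel"
    and B :: "('n, (bool list \<times> nat) gvar) bdd"
  assumes "k \<ge> 1"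
    and "obdd_for (F_CT r k) ord B"
  shows "real (card (nodes B)) \<ge> 2 powr (real (r * k) / 2)"
proof -
  let ?G = "CT r k"
  have obdd: "obdd_for (graph_cnf ?G) ord B" using assms(2) by (simp add: F_CT_def)
  have verts: "verts ?G = subtree [] r \<times> {..<k}"
    by (auto simp: CT_def clique_blowup_def complete_binary_tree_def subtree_def)
  have "edges ?G \<subseteq> Pow (verts ?G)"
    by (auto simp: CT_def clique_blowup_def complete_binary_tree_def doubleton_eq_iff)
  then have "finite (edges ?G)"
    by (rule finite_subset) (simp add: verts)
  then have "finite (cnf_vars (graph_cnf ?G))"
    by (simp add: graph_cnf_def verts)
  then obtain f where f: "\<And>x y. (x, y) \<in> ord \<Longrightarrow> x \<noteq> y \<Longrightarrow> f x < (f y :: nat)"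
    "inj_on f (cnf_vars (graph_cnf ?G))"
    using linear_order_rank obdd unfolding obdd_for_def is_obdd_def by metis
  \<comment> \<open>Only the ranks of vertex variables enter the choice of the cut.\<close>
  have "inj_on (\<lambda>u. f (VertexVar u)) (subtree [] r \<times> {..<k})"
    using f(2) by (auto simp: inj_on_def graph_cnf_def verts)
  then obtain t M where M: "cut_matching k (subtree [] r) {u. f (VertexVar u) < t} M"
    and card_M: "card M = k * ((r + 1) div 2)"
    using subtree_cut_matching by blast
  have "{u, v} \<in> edges ?G" if uv: "(u, v) \<in> M" for u v
  proof -
    obtain p i p' j where e: "u = (p, i)" "v = (p', j)" by force
    have "\<exists>b. p' = p @ [b] \<or> p = p' @ [b]" "i < k" "j < k" "length p \<le> r" "length p' \<le> r"
      using M uv unfolding cut_matching_def e subtree_def by auto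
    then have "{p, p'} \<in> edges (complete_binary_tree r)"
      by (auto simp: complete_binary_tree_def)
    with \<open>i < k\<close> \<open>j < k\<close> show ?thesis
      unfolding CT_def clique_blowup_def e by auto
  qed
  then have crossing: "{u, v} \<in> edges ?G \<and> u \<in> verts ?G \<and> v \<in> verts ?G \<and>
      f (VertexVar u) < t \<and> \<not> f (VertexVar v) < t" if "(u, v) \<in> M" for u v
    using M that unfolding cut_matching_def verts by auto
  have "finite M"
    using M unfolding cut_matching_def
    by (meson finite_Diff finite_Int finite_SigmaI finite_lessThan finite_subset finite_subtree)
  then have bound: "2 ^ card M \<le> card (nodes B)"
    using graph_cnf_matching_bound[OF obdd f(1) _ _ _ crossing] M
    unfolding cut_matching_def by blast
  \<comment> \<open>Rounding up in \<open>(r + 1) div 2\<close> gives the exponent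
    \<open>r * k / 2\<close> for odd \<open>r\<close> as well.\<close>
  have "r \<le> 2 * ((r + 1) div 2)" by simp
  then have "r * k \<le> 2 * card M"
    unfolding card_M by (metis mult.assoc mult.commute mult_le_mono1)
  then have "real (r * k) / 2 \<le> real (card M)" by linarith
  then have "2 powr (real (r * k) / 2) \<le> 2 powr real (card M)" by simp
  also have "\<dots> = real (2 ^ card M)" by (simp add: powr_realpow)
  also have "\<dots> \<le> real (card (nodes B))" using bound by linarith
  finally show ?thesis .
qed

end
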